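(* Let $(m,n)$ be a coprime pair of positive integers, let $D\in\mathcal D_{m,n}$ have $(S,W)$-word $\Sigma$, and let $R^{(0)}=(r^{(0)}_1,\dots,r^{(0)}_{m+n})$ be any weakly increasing sequence of nonnegative integers. Then the WeakFindRank algorithm started at $T(\Sigma,R^{(0)})$ terminates with a balanced path diagram $T(\Sigma,\overline R)$, where $\overline R=(\overline r_1,\dots,\overline r_{m+n})$. Moreover, $\overline R$ is strictly increasing, and the sequence $$\widetilde R=(0,\ \overline r_2-\overline r_1,\ \overline r_3-\overline r_1,\ \dots,\ \overline r_{m+n}-\overline r_1)$$ is the increasing rearrangement of the rank sequence of a pre-image $\overline D$ of $D$ under the sweep map.
   Context: An $(m,n)$-Dyck path is a lattice path from $(0,0)$ to $(m,n)$ made of $n$ North steps and $m$ East steps staying weakly above $y=nx/m$; $\mathcal D_{m,n}$ is their set. Ranks of vertices along a path: start with $0$, add $m$ after each North step, subtract $n$ after each East step. The rank sequence of a path is the sequence of ranks of the starting points of its $m+n$ steps. The $(S,W)$-word writes $S$ for each North step and $W$ for each East step. The sweep map sends $\overline D\in\mathcal D_{m,n}$ to the path whose steps are those of $\overline D$ rearranged in increasing order of the ranks of their starting points; $\overline D$ is a pre-image of that path. Path diagram $T(\Sigma,R)$ for a word $\Sigma=\Sigma_1\cdots\Sigma_{m+n}$ with $n$ letters $S$ and $m$ letters $W$ and an integer sequence $R=(r_1,\dots,r_{m+n})$: arrows $A_1,\dots,A_{m+n}$, where $A_i$ goes from $(i-1,r_i)$ to $(i,r_i+m)$ (red) if $\Sigma_i=S$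 and from $(i-1,r_i)$ to $(i,r_i-n)$ (blue) if $\Sigma_i=W$; $A_i$ starts at level $r_i$. Row $j$ ($j\in\mathbb Z$) is the strip between $y=j$ and $y=j+1$; a red arrow with starting rank $r$ has a segment in rows $r,\dots,r+m-1$, a blue one in rows $r-n,\dots,r-1$. The row count $c(j)$ is the number of red minus the number of blue arrows having a segment in row $j$. $T(\Sigma,R)$ is balanced if all row counts vanish. WeakFindRank algorithm: start with $R=R^{(0)}$. Repeat: if all row counts of $T(\Sigma,R)$ are $\le 0$, stop and output $R$. Otherwise let $j$ be the lowest row with $c(j)>0$, let $i$ be the largest index with $r_i=j$, and replace $r_i$ by $r_i+1$, keeping the other entries. *)

theory Defs
  imports Complex_Main
begin

datatype step = North | East

datatype letter = S | W

text \<open>A lattice path from the origin is given by its list of steps. Since the points of a step lie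
  weakly above the line as soon as both of its end points do, only the vertices are tested.\<close>

definition vertex :: "step list \<Rightarrow> nat \<Rightarrow> nat \<times> nat" where
  "vertex p k = (count_list (take k p) East, count_list (take k p) North)"

definition dyck_paths :: "nat \<Rightarrow> nat \<Rightarrow> step list set" where
  "dyck_paths m n =
     {p. count_list p North = n \<and> count_list p East = m \<and>
         (\<forall>k\<le>length p. case vertex p k of (x, y) \<Rightarrow> real n * real x / real m \<le> real y)}"

fun letter_of :: "step \<Rightarrow> letter" where
  "letter_of North = S"
| "letter_of East = W"

definition sw_word :: "step list \<Rightarrow> letter list" where
  "sw_word p = map letter_of p"

fun ranks_from :: "nat \<Rightarrow> nat \<Rightarrow> int \<Rightarrow> step list \<Rightarrow> int list" where
  "ranks_from m n r [] = []"
| "ranks_from m n r (North # p) = r # ranks_from m n (r + int m) p"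
| "ranks_from m n r (East # p) = r # ranks_from m n (r - int n) p"

definition rank_seq :: "nat \<Rightarrow> nat \<Rightarrow> step list \<Rightarrow> int list" where
  "rank_seq m n p = ranks_from m n 0 p"

text \<open>For coprime \<open>m\<close> and \<open>n\<close> the ranks of the starting points of an \<open>(m, n)\<close>-Dyck path are
  distinct, so that the stability of \<^const>\<open>sort_key\<close> plays no role.\<close>

definition sweep :: "nat \<Rightarrow> nat \<Rightarrow> step list \<Rightarrow> step list" where
  "sweep m n p = map snd (sort_key fst (zip (rank_seq m n p) p))"

text \<open>A path diagram is given by a word and an integer list of the same length. Positions are
  counted from 0. \<open>arrow_rows m n a r\<close> is the set of rows in which the arrow with letter \<open>a\<close>
  and starting level \<open>r\<close> has a segment, where row \<open>j\<close> is the strip between \<open>y = j\<close> and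
  \<open>y = j + 1\<close>.\<close>

fun arrow_rows :: "nat \<Rightarrow> nat \<Rightarrow> letter \<Rightarrow> int \<Rightarrow> int set" where
  "arrow_rows m n S r = {r..<r + int m}"
| "arrow_rows m n W r = {r - int n..<r}"

definition row_count :: "nat \<Rightarrow> nat \<Rightarrow> letter list \<Rightarrow> int list \<Rightarrow> int \<Rightarrow> int" where
  "row_count m n \<Sigma> R j =
     int (card {i. i < length \<Sigma> \<and> \<Sigma> ! i = S \<and> j \<in> arrow_rows m n S (R ! i)}) -
     int (card {i. i < length \<Sigma> \<and> \<Sigma> ! i = W \<and> j \<in> arrow_rows m n W (R ! i)})"

definition balanced :: "nat \<Rightarrow> nat \<Rightarrow> letter list \<Rightarrow> int list \<Rightarrow> bool" where
  "balanced m n \<Sigma> R \<longleftrightarrow> (\<forall>j. row_count m n \<Sigma> R j = 0)"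

text \<open>One iteration of the loop. It is a relation rather than a function, so that the algorithm
  would get stuck, instead of continuing with an arbitrary index, if no arrow started at level
  \<open>j\<close>.\<close>

inductive wfr_step :: "nat \<Rightarrow> nat \<Rightarrow> letter list \<Rightarrow> int list \<Rightarrow> int list \<Rightarrow> bool"
  for m n :: nat and \<Sigma> :: "letter list" where
  "\<lbrakk>0 < row_count m n \<Sigma> R j;
    \<forall>k<j. \<not> 0 < row_count m n \<Sigma> R k;
    i < length R; R ! i = j;
    \<forall>k<length R. R ! k = j \<longrightarrow> k \<le> i\<rbrakk>
   \<Longrightarrow> wfr_step m n \<Sigma> R (R[i := R ! i + 1])"

definition wfr_halted :: "nat \<Rightarrow> nat \<Rightarrow> letter list \<Rightarrow> int list \<Rightarrow> bool" where
  "wfr_halted m n \<Sigma> R \<longleftrightarrow> (\<forall>j. row_count m n \<Sigma> R j \<le> 0)"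

text \<open>The algorithm, started at the first list, terminates with the second one. The lemmas below
  show that the run is deterministic, so that reaching a halting state means termination and the
  output is unique.\<close>

definition weak_find_rank :: "nat \<Rightarrow> nat \<Rightarrow> letter list \<Rightarrow> int list \<Rightarrow> int list \<Rightarrow> bool" where
  "weak_find_rank m n \<Sigma> R R' \<longleftrightarrow> (wfr_step m n \<Sigma>)\<^sup>*\<^sup>* R R' \<and> wfr_halted m n \<Sigma> R'"

lemma wfr_step_deterministic:
  assumes "wfr_step m n \<Sigma> R R1" "wfr_step m n \<Sigma> R R2"
  shows "R1 = R2"
proof -
  from assms(1) obtain j i where 1: "0 < row_count m n \<Sigma> R j"
    "\<forall>k<j. \<not> 0 < row_count m n \<Sigma> R k" "i < length R" "R ! i = j"
    "\<forall>k<length R. R ! k = j \<longrightarrow> k \<le> i" "R1 = R[i := R ! i + 1]"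
    by (auto elim: wfr_step.cases)
  from assms(2) obtain j' i' where 2: "0 < row_count m n \<Sigma> R j'"
    "\<forall>k<j'. \<not> 0 < row_count m n \<Sigma> R k" "i' < length R" "R ! i' = j'"
    "\<forall>k<length R. R ! k = j' \<longrightarrow> k \<le> i'" "R2 = R[i' := R ! i' + 1]"
    by (auto elim: wfr_step.cases)
  have "j = j'"
    using 1(1,2) 2(1,2) by (meson linorder_cases)
  then have "i = i'"
    using 1(3-5) 2(3-5) by (auto intro: le_antisym)
  then show ?thesis
    using 1(6) 2(6) by simp
qed

lemma wfr_halted_no_step: "wfr_halted m n \<Sigma> R \<Longrightarrow> \<not> wfr_step m n \<Sigma> R R'"
  by (auto simp: wfr_halted_def not_less elim!: wfr_step.cases)
     (meson not_less)

lemma weak_find_rank_unique: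
  assumes "weak_find_rank m n \<Sigma> R R1" "weak_find_rank m n \<Sigma> R R2"
  shows "R1 = R2"
proof -
  have *: "(wfr_step m n \<Sigma>)\<^sup>*\<^sup>* R R1" "wfr_halted m n \<Sigma> R1"
    "(wfr_step m n \<Sigma>)\<^sup>*\<^sup>* R R2" "wfr_halted m n \<Sigma> R2"
    using assms by (auto simp: weak_find_rank_def)
  from *(1) *(3) show ?thesis
  proof (induction rule: converse_rtranclp_induct)
    case base
    then show ?case
      using *(2) by (metis converse_rtranclpE wfr_halted_no_step)
  next
    case (step R R')
    then show ?case
      using *(4) by (metis converse_rtranclpE wfr_halted_no_step wfr_step_deterministic)
  qed
qed

end

theory Submission imports Defs "HOL-Library.Multiset" begin

text \<open>Raising an arrow that starts at level \<open>j\<close> and ends at level \<open>k\<close> by one unit lowers the count of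
  row \<open>j\<close> by 1 and raises that of row \<open>k\<close> by 1. As only positive rows are lowered, no row becomes
  negative during the run. In an infinite run some arrows would tend to infinity while a proper,
  nonempty initial segment of the arrows stays bounded and is eventually fixed. The row counts of
  this segment sum to the rank of a vertex of \<open>D\<close> other than its end points, which is positive by the
  Dyck property and coprimality; so a low row stays positive and the next step moves a low arrow.
  Hence the run stops, and it stops balanced as the row counts sum to 0. In a balanced diagram the
  end of each arrow is the start of another one, and the walk along the arrows is the
  pre-image.\<close>

section \<open>Coprimality and integer sequences\<close>

text \<open>Meant for \<open>a\<close> red and \<open>b\<close> blue arrows: if their displacements
  cancel, their number is a multiple of \<open>m + n\<close>.\<close>

lemma add_dvd_add_of_coprime:
  fixes m n a b :: nat
  assumes "coprime m n" "0 < n" "m * a = n * b"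
  shows "m + n dvd a + b"
proof -
  have "n dvd m * a" using assms(3) by simp
  then have "n dvd a" using assms(1) by (simp add: coprime_dvd_mult_right_iff coprime_commute)
  then obtain t where t: "a = n * t" by (auto simp: dvd_def)
  then have "b = m * t" using assms(2,3) by (simp add: mult.left_commute)
  then show ?thesis using t by (simp add: add.commute flip: add_mult_distrib)
qed

lemma mono_int_seq_eventually_const:
  fixes g :: "nat \<Rightarrow> int"
  assumes "mono g" "\<And>t. g t \<le> b"
  shows "\<exists>T. \<forall>t\<ge>T. g t = g T"
proof -
  have fin: "finite (range g)"
    by (rule finite_subset[of _ "{g 0..b}"]) (use assms in \<open>auto simp: mono_def\<close>)
  then obtain T where "g T = Max (range g)"
    by (metis Max_in UNIV_I empty_iff image_iff rangeI)
  moreover have "g t \<le> Max (range g)" for t using fin by simp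
  ultimately show ?thesis using assms(1) by (metis antisym monoD)
qed

section \<open>Contributions of single arrows to the row counts\<close>

fun displacement :: "nat \<Rightarrow> nat \<Rightarrow> letter \<Rightarrow> int" where
  "displacement m n S = int m"
| "displacement m n W = - int n"

text \<open>The sign records the colour, so that a row count becomes one sum over all
  arrows.\<close>

fun arrow_count :: "nat \<Rightarrow> nat \<Rightarrow> letter \<Rightarrow> int \<Rightarrow> int \<Rightarrow> int" where
  "arrow_count m n S r j = of_bool (r \<le> j \<and> j < r + int m)"
| "arrow_count m n W r j = - of_bool (r - int n \<le> j \<and> j < r)"

lemma row_count_eq_sum:
  "row_count m n \<Sigma> R j = (\<Sum>i<length \<Sigma>. arrow_count m n (\<Sigma> ! i) (R ! i) j)"
proof -
  let ?s = "\<lambda>i. of_bool (\<Sigma> ! i = S \<and> j \<in> arrow_rows m n S (R ! i)) :: int"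
  let ?w = "\<lambda>i. of_bool (\<Sigma> ! i = W \<and> j \<in> arrow_rows m n W (R ! i)) :: int"
  have "arrow_count m n (\<Sigma> ! i) (R ! i) j = ?s i - ?w i" for i
    by (cases "\<Sigma> ! i") auto
  moreover have "(\<Sum>i<length \<Sigma>. of_bool (P i)) = int (card {i. i < length \<Sigma> \<and> P i})" for P
    by (simp add: sum.If_cases of_bool_def Int_def)
  ultimately show ?thesis
    unfolding row_count_def by (simp only: sum_subtractf)
qed

text \<open>A red arrow gives up row \<open>r\<close> and gains row \<open>r + m\<close>. A blue one
  gains row \<open>r\<close> and gives up row \<open>r - n\<close>, and its negative sign leads to
  the same formula.\<close>

lemma arrow_count_Suc:
  "arrow_count m n a (r + 1) j =
     arrow_count m n a r j - of_bool (j = r) + of_bool (j = r + displacement m n a)"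
  by (cases a) auto

lemma arrow_count_pred:
  "arrow_count m n a r j - arrow_count m n a r (j - 1) =
     of_bool (j = r) - of_bool (j = r + displacement m n a)"
  by (cases a) auto

lemma arrow_count_eq_0:
  "j < r - int n \<Longrightarrow> arrow_count m n a r j = 0"
  "r + int m \<le> j \<Longrightarrow> arrow_count m n a r j = 0"
  by (cases a; simp)+

lemma sum_arrow_count:
  assumes "A \<le> r - int n" "r + int m \<le> B"
  shows "(\<Sum>j\<in>{A..<B}. arrow_count m n a r j) = displacement m n a"
proof (cases a)
  case S
  have "{j \<in> {A..<B}. r \<le> j \<and> j < r + int m} = {r..<r + int m}" using assms by auto
  then show ?thesis using S by (simp add: of_bool_def sum.If_cases Int_def)
next
  case W
  have "{j \<in> {A..<B}. r - int n \<le> j \<and> j < r} = {r - int n..<r}" using assms by auto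
  then show ?thesis using W by (simp add: of_bool_def sum_negf sum.If_cases Int_def)
qed

lemma row_count_update:
  assumes "i < length R" "length R = length \<Sigma>"
  shows "row_count m n \<Sigma> (R[i := R ! i + 1]) k =
    row_count m n \<Sigma> R k - of_bool (k = R ! i) + of_bool (k = R ! i + displacement m n (\<Sigma> ! i))"
proof -
  have i: "i \<in> {..<length \<Sigma>}" using assms by simp
  show ?thesis
    using assms unfolding row_count_eq_sum
    by (simp add: sum.remove[OF _ i] arrow_count_Suc)
qed

text \<open>From row \<open>j - 1\<close> to row \<open>j\<close> the contribution of an arrow
  changes by 1 at its start level and by -1 at its end level, whatever its colour. Hence an arrow
  starts wherever the count increases and, in a balanced diagram, wherever another one ends.\<close>

lemma row_count_pred:
  "row_count m n \<Sigma> R j - row_count m n \<Sigma> R (j - 1) =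
     int (card {i. i < length \<Sigma> \<and> R ! i = j}) -
     int (card {i. i < length \<Sigma> \<and> R ! i + displacement m n (\<Sigma> ! i) = j})"
proof -
  have "(\<Sum>i<length \<Sigma>. of_bool (P i)) = int (card {i. i < length \<Sigma> \<and> P i})" for P
    by (simp add: sum.If_cases of_bool_def Int_def)
  then show ?thesis
    unfolding row_count_eq_sum sum_subtractf[symmetric] arrow_count_pred
    by (simp add: sum_subtractf eq_commute[of j])
qed

section \<open>Steps of the algorithm and their invariants\<close>

text \<open>The lowest positive row has a larger count than the row beneath it, so by
  \<open>row_count_pred\<close> some arrow starts there.\<close>

lemma wfr_step_exists:
  assumes len: "length R = length \<Sigma>" and "\<not> wfr_halted m n \<Sigma> R"
  shows "\<exists>R'. wfr_step m n \<Sigma> R R'"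
proof -
  let ?c = "row_count m n \<Sigma> R"
  \<comment> \<open>No arrow reaches below \<open>L\<close>, so the lowest positive row can be
    sought over the naturals. Inserting 0 keeps \<open>Min\<close> meaningful for the empty
    list.\<close>
  define L where "L = Min (insert 0 (set R)) - int n"
  have low: "?c j = 0" if "j < L" for j
  proof -
    have "j < R ! i - int n" if "i < length \<Sigma>" for i
    proof -
      have "Min (insert 0 (set R)) \<le> R ! i" using that len by (intro Min_le) auto
      then show ?thesis using \<open>j < L\<close> by (simp add: L_def)
    qed
    then show ?thesis by (simp add: row_count_eq_sum arrow_count_eq_0)
  qed
  obtain j0 where "?c j0 > 0" using assms(2) by (auto simp: wfr_halted_def not_le)
  then have "?c (L + int (nat (j0 - L))) > 0" using low[of j0] by (cases "j0 < L") auto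
  then obtain d where d: "?c (L + int d) > 0" "\<And>d'. d' < d \<Longrightarrow> \<not> ?c (L + int d') > 0"
    using exists_least_iff[of "\<lambda>d. ?c (L + int d) > 0"] by blast
  define j where "j = L + int d"
  have least: "\<not> ?c k > 0" if "k < j" for k
    using low[of k] d(2)[of "nat (k - L)"] that by (cases "k < L") (auto simp: j_def)
  let ?I = "{i. i < length \<Sigma> \<and> R ! i = j}"
  have "card ?I > 0"
    using row_count_pred[of m n \<Sigma> R j] least[of "j - 1"] d(1) unfolding j_def[symmetric] by auto
  then have ne: "?I \<noteq> {}" "finite ?I" by (auto simp: card_gt_0_iff)
  from Max_in[OF ne(2,1)] have "Max ?I \<in> ?I" .
  then have "wfr_step m n \<Sigma> R (R[Max ?I := R ! Max ?I + 1])"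
    using d(1) least len by (intro wfr_step.intros[of _ _ _ _ j]) (auto simp: j_def)
  then show ?thesis ..
qed

lemma wfr_step_length: "wfr_step m n \<Sigma> R R' \<Longrightarrow> length R' = length R"
  by (auto elim: wfr_step.cases)

text \<open>The choice of the largest index matters: every later entry exceeds the raised one and so
  is at least its new value.\<close>

lemma wfr_step_sorted:
  assumes "wfr_step m n \<Sigma> R R'" "sorted R"
  shows "sorted R'"
proof -
  from assms(1) obtain i where i: "i < length R" "\<forall>k<length R. R ! k = R ! i \<longrightarrow> k \<le> i"
    "R' = R[i := R ! i + 1]" by (auto elim!: wfr_step.cases)
  have "R' ! a \<le> R' ! b" if "a < b" "b < length R" for a b
  proof -
    have "R ! a \<le> R ! b" using that assms(2) by (simp add: sorted_nth_mono)
    moreover have "R ! a \<noteq> R ! b" if "a = i"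
      using i(2) \<open>a < b\<close> \<open>b < length R\<close> that by (metis not_le)
    ultimately show ?thesis using that i(3) by (cases "a = i"; cases "b = i") auto
  qed
  then show ?thesis using i by (auto simp: sorted_iff_nth_mono_less)
qed

lemma wfr_step_nth_mono:
  assumes "wfr_step m n \<Sigma> R R'"
  shows "R ! k \<le> R' ! k"
proof -
  from assms obtain i where "i < length R" "R' = R[i := R ! i + 1]"
    by (auto elim: wfr_step.cases)
  then show ?thesis by (cases "k = i") auto
qed

lemma wfr_step_row_count_nonneg:
  assumes "wfr_step m n \<Sigma> R R'" "length R = length \<Sigma>" "0 \<le> row_count m n \<Sigma> R k"
  shows "0 \<le> row_count m n \<Sigma> R' k"
  using assms by (auto elim!: wfr_step.cases simp: row_count_update)

lemma rtranclp_step_invariants: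
  assumes "(wfr_step m n \<Sigma>)\<^sup>*\<^sup>* R R'" "sorted R"
  shows "length R' = length R \<and> sorted R'"
  using assms by (induction rule: rtranclp_induct) (auto simp: wfr_step_length wfr_step_sorted)

section \<open>Ranks along a path and the Dyck condition\<close>

lemma sum_displacement:
  "(\<Sum>i<length p. displacement m n (letter_of (p ! i))) =
     int m * int (count_list p North) - int n * int (count_list p East)"
proof (induction p)
  case (Cons a p)
  then show ?case
    by (cases a) (simp_all add: sum.lessThan_Suc_shift algebra_simps del: sum.lessThan_Suc)
qed simp

lemma length_eq_count: "length p = count_list p North + count_list p East"
proof (induction p)
  case (Cons a p)
  then show ?case by (cases a) auto
qed simp

lemma length_ranks_from: "length (ranks_from m n r p) = length p"
  by (induction m n r p rule: ranks_from.induct) auto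

lemma ranks_from_nth:
  "l < length p \<Longrightarrow>
     ranks_from m n r p ! l = r + (\<Sum>i<l. displacement m n (letter_of (p ! i)))"
proof (induction m n r p arbitrary: l rule: ranks_from.induct)
  case (2 m n r p)
  then show ?case by (cases l) (simp_all add: sum.lessThan_Suc_shift del: sum.lessThan_Suc)
next
  case (3 m n r p)
  then show ?case by (cases l) (simp_all add: sum.lessThan_Suc_shift del: sum.lessThan_Suc)
qed simp

lemma sum_displacement_take:
  assumes "k \<le> length p"
  shows "(\<Sum>i<k. displacement m n (letter_of (p ! i))) =
     int m * int (count_list (take k p) North) - int n * int (count_list (take k p) East)"
  using sum_displacement[of m n "take k p"] assms by simp

text \<open>Clearing the denominator turns the comparison with the line into the sign of the
  rank.\<close>

lemma dyck_paths_iff: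
  assumes "0 < m"
  shows "p \<in> dyck_paths m n \<longleftrightarrow> count_list p North = n \<and> count_list p East = m \<and>
    (\<forall>k\<le>length p. 0 \<le> (\<Sum>i<k. displacement m n (letter_of (p ! i))))"
proof -
  have "real n * real x / real m \<le> real y \<longleftrightarrow> 0 \<le> int m * int y - int n * int x" for x y
  proof -
    have "real n * real x / real m \<le> real y \<longleftrightarrow> real (n * x) \<le> real (m * y)"
      using assms by (simp add: pos_divide_le_eq mult.commute)
    also have "\<dots> \<longleftrightarrow> int (n * x) \<le> int (m * y)" by linarith
    finally show ?thesis by simp
  qed
  then show ?thesis
    by (simp add: dyck_paths_def vertex_def sum_displacement_take)
qed

section \<open>Row sums for the word of a Dyck path\<close>

locale dyck_word =
  fixes m n :: nat and D :: "step list" and \<Sigma> :: "letter list"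
  assumes m_pos: "0 < m" and n_pos: "0 < n" and coprime: "coprime m n"
    and dyck: "D \<in> dyck_paths m n" and word: "\<Sigma> = sw_word D"
begin

abbreviation d :: "nat \<Rightarrow> int" where "d i \<equiv> displacement m n (\<Sigma> ! i)"

lemma length_D: "length D = m + n"
  using dyck by (simp add: length_eq_count dyck_paths_def)

lemma length_word: "length \<Sigma> = m + n"
  by (simp add: word sw_word_def length_D)

lemma nth_word: "i < m + n \<Longrightarrow> \<Sigma> ! i = letter_of (D ! i)"
  by (simp add: word sw_word_def length_D)

lemma sum_d_eq: "k \<le> m + n \<Longrightarrow> (\<Sum>i<k. d i) = (\<Sum>i<k. displacement m n (letter_of (D ! i)))"
  by (rule sum.cong) (auto simp: nth_word)

lemma sum_d: "(\<Sum>i<m + n. d i) = 0"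
  using dyck sum_displacement[of m n D] by (simp add: sum_d_eq length_D dyck_paths_def)

text \<open>With \<open>a\<close> letters \<open>S\<close> and \<open>b\<close> letters
  \<open>W\<close> the sum is \<open>m * a - n * b\<close>. The labelling \<open>f\<close> is
  arbitrary because it is read both along the word and along a walk of arrows.\<close>

lemma dvd_if_sum_eq_0:
  assumes "finite A" "(\<Sum>i\<in>A. displacement m n (f i)) = 0"
  shows "m + n dvd card A"
proof -
  define a where "a = card {i\<in>A. f i = S}"
  define b where "b = card {i\<in>A. f i = W}"
  have "A = {i\<in>A. f i = S} \<union> {i\<in>A. f i = W}" using letter.exhaust by blast
  then have ab: "card A = a + b"
    unfolding a_def b_def using assms(1) by (subst card_Un_disjoint[symmetric]) auto
  have "displacement m n (f i) = (if f i = S then int m else 0) + (if f i = W then - int n else 0)"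
    for i by (cases "f i") auto
  then have "(\<Sum>i\<in>A. displacement m n (f i)) = int m * int a - int n * int b"
    using assms(1) by (simp add: sum.distrib sum.If_cases a_def b_def Int_def)
  then have "int (m * a) = int (n * b)" using assms(2) by simp
  then have "m * a = n * b" by linarith
  then show ?thesis
    unfolding ab using coprime n_pos by (rule add_dvd_add_of_coprime[rotated 2])
qed

text \<open>The sum is the rank of vertex \<open>k\<close> of \<open>D\<close>, hence nonnegative;
  if it vanished, \<open>m + n\<close> would divide \<open>k\<close>.\<close>

lemma sum_d_pos:
  assumes "0 < k" "k < m + n"
  shows "0 < (\<Sum>i<k. d i)"
proof -
  have "0 \<le> (\<Sum>i<k. d i)"
    using assms(2) dyck m_pos by (simp add: sum_d_eq dyck_paths_iff length_D)
  moreover have "(\<Sum>i<k. d i) \<noteq> 0"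
    using dvd_if_sum_eq_0[of "{..<k}" "\<lambda>i. \<Sigma> ! i"] nat_dvd_not_less[OF assms]
    by (metis card_lessThan finite_lessThan)
  ultimately show ?thesis by simp
qed

text \<open>Summed by arrows instead of rows, each arrow contributes its displacement, and
  \<open>D\<close> ends at rank 0.\<close>

lemma sum_row_count:
  assumes "length R = m + n" "\<And>i. i < m + n \<Longrightarrow> A \<le> R ! i - int n \<and> R ! i + int m \<le> B"
  shows "(\<Sum>j\<in>{A..<B}. row_count m n \<Sigma> R j) = 0"
proof -
  have "(\<Sum>j\<in>{A..<B}. row_count m n \<Sigma> R j) =
      (\<Sum>i<m + n. \<Sum>j\<in>{A..<B}. arrow_count m n (\<Sigma> ! i) (R ! i) j)"
    unfolding row_count_eq_sum length_word by (rule sum.swap)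
  also have "\<dots> = (\<Sum>i<m + n. d i)" using assms(2) by (intro sum.cong) (auto simp: sum_arrow_count)
  finally show ?thesis using sum_d by simp
qed

lemma row_count_support:
  assumes "length R = m + n"
  obtains A B where "(\<Sum>j\<in>{A..<B}. row_count m n \<Sigma> R j) = 0"
    "\<And>j. j \<notin> {A..<B} \<Longrightarrow> row_count m n \<Sigma> R j = 0"
proof -
  define A where "A = Min (set R) - int n"
  define B where "B = Max (set R) + int m"
  have AB: "A \<le> R ! i - int n \<and> R ! i + int m \<le> B" if "i < m + n" for i
    using that assms by (auto simp: A_def B_def)
  have "row_count m n \<Sigma> R j = 0" if "j \<notin> {A..<B}" for j
    unfolding row_count_eq_sum length_word
  proof (intro sum.neutral ballI)
    fix i assume "i \<in> {..<m + n}"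
    then show "arrow_count m n (\<Sigma> ! i) (R ! i) j = 0"
      using AB[of i] that arrow_count_eq_0(1)[of j "R ! i" n m] arrow_count_eq_0(2)[of "R ! i" m j n]
      by (cases "j < A") auto
  qed
  then show thesis using sum_row_count[OF assms AB] by (intro that)
qed

text \<open>Only finitely many rows are occupied and their counts sum to 0. The nonpositive case
  settles halted diagrams; the nonnegative one rules out that all arrows escape to infinity.\<close>

lemma row_count_eq_0_if_one_sided:
  assumes "length R = m + n"
    and "(\<forall>j. row_count m n \<Sigma> R j \<le> 0) \<or> (\<forall>j. 0 \<le> row_count m n \<Sigma> R j)"
  shows "row_count m n \<Sigma> R j = 0"
proof -
  let ?c = "row_count m n \<Sigma> R"
  obtain A B where AB: "sum ?c {A..<B} = 0" "\<And>j. j \<notin> {A..<B} \<Longrightarrow> ?c j = 0"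
    using row_count_support[OF assms(1)] by blast
  have "\<forall>j\<in>{A..<B}. ?c j = 0"
    using assms(2)
  proof
    assume "\<forall>j. ?c j \<le> 0"
    then show ?thesis using AB(1) sum_nonneg_eq_0_iff[of "{A..<B}" "\<lambda>j. - ?c j"]
      by (simp add: sum_negf)
  next
    assume "\<forall>j. 0 \<le> ?c j"
    then show ?thesis using AB(1) sum_nonneg_eq_0_iff[of "{A..<B}" ?c] by simp
  qed
  then show ?thesis using AB(2)[of j] by (cases "j \<in> {A..<B}") auto
qed

lemma halted_balanced:
  assumes "length R = m + n" "wfr_halted m n \<Sigma> R"
  shows "balanced m n \<Sigma> R"
  using row_count_eq_0_if_one_sided[OF assms(1)] assms(2)
  unfolding balanced_def wfr_halted_def by blast

section \<open>Termination\<close>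

lemma no_infinite_run:
  assumes step: "\<And>t. wfr_step m n \<Sigma> (f t) (f (Suc t))"
    and len0: "length (f 0) = m + n" and sorted0: "sorted (f 0)"
  shows False
proof -
  have len: "length (f t) = m + n" for t
    using len0 by (induction t) (simp_all add: wfr_step_length[OF step])
  have sorted: "sorted (f t)" for t
    using sorted0 by (induction t) (simp_all add: wfr_step_sorted[OF step])
  have mono: "mono (\<lambda>t. f t ! k)" for k
    using wfr_step_nth_mono[OF step] by (simp add: mono_iff_le_Suc)
  have nonneg: "0 \<le> row_count m n \<Sigma> (f t) j" if "0 \<le> row_count m n \<Sigma> (f 0) j" for t j
    using that
    by (induction t) (simp_all add: wfr_step_row_count_nonneg[OF step] len length_word)
  have not_halted: "\<not> wfr_halted m n \<Sigma> (f t)" for t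
    using step wfr_halted_no_step by blast
  define bdd where "bdd k \<longleftrightarrow> (\<exists>b. \<forall>t. f t ! k \<le> b)" for k
  \<comment> \<open>Otherwise all arrows would eventually lie above the rows that were negative at the start, so
    that no row count is negative.\<close>
  have bdd0: "bdd 0"
  proof (rule ccontr)
    assume unb: "\<not> bdd 0"
    obtain A B where AB: "\<And>j. j \<notin> {A..<B} \<Longrightarrow> row_count m n \<Sigma> (f 0) j = 0"
      using row_count_support[OF len0] by blast
    \<comment> \<open>The extra \<open>n\<close> allows for blue arrows: as arrow 0 starts lowest,
      no arrow meets a row below \<open>B\<close>.\<close>
    obtain t where t: "f t ! 0 > B + int n" using unb by (force simp: bdd_def not_le)
    have "0 \<le> row_count m n \<Sigma> (f t) j" for j
    proof (cases "j < B")
      case below: True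
      have "arrow_count m n (\<Sigma> ! i) (f t ! i) j = 0" if "i < m + n" for i
      proof -
        have "f t ! 0 \<le> f t ! i" using that sorted len by (simp add: sorted_nth_mono)
        then show ?thesis using t below by (intro arrow_count_eq_0(1)) linarith
      qed
      then show ?thesis by (simp add: row_count_eq_sum length_word)
    next
      case False
      then show ?thesis using AB[of j] nonneg[of j t] by simp
    qed
    then have "wfr_halted m n \<Sigma> (f t)"
      using row_count_eq_0_if_one_sided[OF len, of t] unfolding wfr_halted_def
      by (metis order_refl)
    then show False using not_halted by blast
  qed
  \<comment> \<open>If every arrow were bounded, all would be fixed from a common time on, yet each
    step raises one.\<close>
  have not_all: "\<exists>k<m + n. \<not> bdd k"
  proof (rule ccontr)
    assume "\<not> ?thesis"
    then have "\<forall>k. \<exists>T. k < m + n \<longrightarrow> (\<forall>t\<ge>T. f t ! k = f T ! k)"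
      using mono_int_seq_eventually_const[OF mono] unfolding bdd_def by metis
    then obtain T where T: "\<And>k t. k < m + n \<Longrightarrow> t \<ge> T k \<Longrightarrow> f t ! k = f (T k) ! k"
      by metis
    define T' where "T' = Max (T ` {..<m + n})"
    have T': "T k \<le> T'" if "k < m + n" for k using that by (simp add: T'_def)
    have "f (Suc T') ! k = f T' ! k" if "k < m + n" for k
      using T[OF that, of "Suc T'"] T[OF that, of T'] T'[OF that] by simp
    then have "f (Suc T') = f T'" by (intro nth_equalityI) (simp_all add: len)
    then show False using step[of T']
      by (auto elim!: wfr_step.cases simp: list_eq_iff_nth_eq nth_list_update)
  qed
  \<comment> \<open>The arrows before the first unbounded one are frozen from a common time
    \<open>T'\<close> on.\<close>
  define k where "k = (LEAST k. \<not> bdd k)"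
  have unb_k: "\<not> bdd k" and bdd_less: "\<And>i. i < k \<Longrightarrow> bdd i" and k_less: "k < m + n"
    using not_all unfolding k_def
    by (metis LeastI, metis not_less_Least, metis Least_le le_less_trans)
  have k_pos: "0 < k" using unb_k bdd0 by (metis neq0_conv)
  have "\<forall>i. \<exists>T. i < k \<longrightarrow> (\<forall>t\<ge>T. f t ! i = f T ! i)"
    using mono_int_seq_eventually_const[OF mono] bdd_less unfolding bdd_def by metis
  then obtain T where T: "\<And>i t. i < k \<Longrightarrow> t \<ge> T i \<Longrightarrow> f t ! i = f (T i) ! i"
    by metis
  define T' where "T' = Max (T ` {..<k})"
  have T': "T i \<le> T'" if "i < k" for i using that by (simp add: T'_def)
  have const: "f t ! i = f T' ! i" if "i < k" "T' \<le> t" for i t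
    using T[OF that(1), of t] T[OF that(1), of T'] T'[OF that(1)] that(2) by simp
  define M where "M = f T' ! (k - 1) + int m"
  \<comment> \<open>Beyond \<open>M + n\<close> even a blue arrow stays above \<open>M\<close>; by
    sortedness this applies to all arrows from \<open>k\<close> on.\<close>
  obtain t0 where "f t0 ! k > M + int n" using unb_k by (force simp: bdd_def not_le)
  then obtain t where t: "t \<ge> T'" "f t ! k > M + int n"
    using monoD[OF mono, of t0 "max t0 T'" k] by (intro that[of "max t0 T'"]) auto
  let ?R = "f t"
  have srt: "?R ! i \<le> ?R ! i'" if "i \<le> i'" "i' < m + n" for i i'
    using that sorted len by (simp add: sorted_nth_mono)
  have low: "?R ! i + int m \<le> M" if "i < k" for i
    using srt[of i "k - 1"] const[of "k - 1" t] that t(1) k_less by (simp add: M_def)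
  have high: "M < ?R ! i - int n" if "k \<le> i" "i < m + n" for i
    using srt[of k i] that t(2) by simp
  define A where "A = ?R ! 0 - int n"
  have "(\<Sum>j\<in>{A..<M}. row_count m n \<Sigma> ?R j) =
      (\<Sum>i<m + n. \<Sum>j\<in>{A..<M}. arrow_count m n (\<Sigma> ! i) (?R ! i) j)"
    unfolding row_count_eq_sum length_word by (rule sum.swap)
  also have "\<dots> = (\<Sum>i<m + n. if i < k then d i else 0)"
  proof (intro sum.cong refl)
    fix i assume i: "i \<in> {..<m + n}"
    show "(\<Sum>j\<in>{A..<M}. arrow_count m n (\<Sigma> ! i) (?R ! i) j) = (if i < k then d i else 0)"
    proof (cases "i < k")
      case True
      then show ?thesis using low[of i] srt[of 0 i] i by (simp add: sum_arrow_count A_def)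
    next
      case False
      then show ?thesis using high[of i] i by (auto intro!: sum.neutral arrow_count_eq_0(1))
    qed
  qed
  also have "\<dots> = (\<Sum>i<k. d i)"
    using k_less by (intro sum.mono_neutral_cong_right) auto
  also have "\<dots> > 0" using k_pos k_less by (rule sum_d_pos)
  finally obtain j where j: "j < M" "row_count m n \<Sigma> ?R j > 0"
    by (metis sum_nonpos not_le atLeastLessThan_iff)
  \<comment> \<open>The step acts in the lowest positive row, hence at or below \<open>j\<close>,
    and so moves an arrow frozen since \<open>T'\<close>.\<close>
  obtain i where i: "i < m + n" "?R ! i \<le> j" "f (Suc t) = ?R[i := ?R ! i + 1]"
    using step[of t]
  proof cases
    case (1 j' i)
    have "j' \<le> j" using 1(3) j(2) by (meson not_le)
    then show thesis using 1 len that[of i] by simp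
  qed
  then have "i < k" using high[of i] j(1) by (cases "i < k") auto
  then show False using const[of i t] const[of i "Suc t"] t(1) i len by simp
qed

text \<open>If no halted diagram could be reached, every diagram reached would admit a step, and
  iterating the choice \<open>g\<close> would give an infinite run.\<close>

lemma terminates:
  assumes "length R0 = m + n" "sorted R0"
  shows "\<exists>R. weak_find_rank m n \<Sigma> R0 R"
proof (rule ccontr)
  assume no: "\<not> ?thesis"
  define g where "g R = (SOME R'. wfr_step m n \<Sigma> R R')" for R
  define f where "f t = (g ^^ t) R0" for t
  have "(wfr_step m n \<Sigma>)\<^sup>*\<^sup>* R0 (f t) \<and> wfr_step m n \<Sigma> (f t) (f (Suc t))" for t
  proof (induction t)
    case 0
    have "\<not> wfr_halted m n \<Sigma> R0" using no by (auto simp: weak_find_rank_def)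
    then show ?case
      using wfr_step_exists[of R0] assms by (simp add: f_def g_def length_word someI_ex)
  next
    case (Suc t)
    then have run: "(wfr_step m n \<Sigma>)\<^sup>*\<^sup>* R0 (f (Suc t))" by auto
    then have "\<not> wfr_halted m n \<Sigma> (f (Suc t))" using no by (auto simp: weak_find_rank_def)
    then have "\<exists>R'. wfr_step m n \<Sigma> (f (Suc t)) R'"
      using rtranclp_step_invariants[OF run assms(2)] assms
      by (intro wfr_step_exists) (auto simp: length_word)
    then have "wfr_step m n \<Sigma> (f (Suc t)) (g (f (Suc t)))" unfolding g_def by (rule someI_ex)
    then show ?case using run by (simp add: f_def)
  qed
  then show False
    using no_infinite_run[of f] assms by (simp add: f_def)
qed

section \<open>From a balanced diagram to the pre-image\<close>

text \<open>Equal counts in the rows on both sides of a level mean that as many arrows start there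
  as end there, and arrow \<open>i\<close> ends at \<open>R ! i + d i\<close>.\<close>

lemma balanced_next_arrow:
  assumes "balanced m n \<Sigma> R" "i < m + n"
  shows "\<exists>i'<m + n. R ! i' = R ! i + d i"
proof -
  let ?E = "{i'. i' < length \<Sigma> \<and> R ! i' + d i' = R ! i + d i}"
  let ?B = "{i'. i' < length \<Sigma> \<and> R ! i' = R ! i + d i}"
  have "card ?B = card ?E"
    using row_count_pred[of m n \<Sigma> R "R ! i + d i"] assms(1) by (simp add: balanced_def)
  moreover have "i \<in> ?E" using assms(2) by (simp add: length_word)
  then have "card ?E > 0" by (auto simp: card_gt_0_iff)
  ultimately have "card ?B > 0" by simp
  then have "?B \<noteq> {}" by (metis card.empty less_irrefl)
  then show ?thesis by (auto simp: length_word)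
qed

text \<open>Follow the arrows of a balanced diagram. By coprimality a walk returns to a level only after
  a multiple of \<open>m + n\<close> arrows, so the first \<open>m + n\<close> arrows of the walk start at distinct levels
  and exhaust the diagram.\<close>

lemma balanced_walk:
  assumes bal: "balanced m n \<Sigma> R"
  obtains x where "x 0 = 0" "bij_betw x {..<m + n} {..<m + n}" "inj_on (\<lambda>i. R ! i) {..<m + n}"
    "\<And>l. x l < m + n" "\<And>l. R ! x l = R ! 0 + (\<Sum>i<l. d (x i))"
proof -
  obtain s where s: "\<And>i. i < m + n \<Longrightarrow> s i < m + n \<and> R ! s i = R ! i + d i"
    using balanced_next_arrow[OF bal] by metis
  define x where "x l = (s ^^ l) 0" for l
  have x0: "x 0 = 0" by (simp add: x_def)
  have range: "x l < m + n" for l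
    by (induction l) (use m_pos s in \<open>auto simp: x_def\<close>)
  have Suc: "R ! x (Suc l) = R ! x l + d (x l)" for l
    using s[OF range[of l]] by (simp add: x_def)
  have level: "R ! x l' = R ! x l + (\<Sum>i\<in>{l..<l'}. d (x i))" if "l \<le> l'" for l l'
    using that by (induction l' rule: dec_induct) (auto simp: Suc)
  have "inj_on (\<lambda>l. R ! x l) {..<m + n}"
  proof (rule linorder_inj_onI)
    fix l l' assume ll: "l < l'" "l' \<in> {..<m + n}"
    show "R ! x l \<noteq> R ! x l'"
    proof
      assume "R ! x l = R ! x l'"
      then have "(\<Sum>i\<in>{l..<l'}. d (x i)) = 0" using level[of l l'] ll by simp
      then have "m + n dvd l' - l"
        using dvd_if_sum_eq_0[of "{l..<l'}" "\<lambda>i. \<Sigma> ! x i"] by simp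
      then show False using ll by (auto dest: dvd_imp_le)
    qed
  qed auto
  \<comment> \<open>Distinct levels along the walk make \<open>x\<close> injective, hence a
    permutation of the positions; this in turn makes all start levels in \<open>R\<close>
    distinct.\<close>
  then have inj: "inj_on ((\<lambda>i. R ! i) \<circ> x) {..<m + n}" by (simp add: comp_def)
  then have "inj_on x {..<m + n}" by (rule inj_on_imageI2)
  moreover from this have "x ` {..<m + n} = {..<m + n}"
    using range by (intro endo_inj_surj) auto
  ultimately have "bij_betw x {..<m + n} {..<m + n}" "inj_on (\<lambda>i. R ! i) {..<m + n}"
    using inj inj_on_imageI[OF inj] by (auto simp: bij_betw_def)
  moreover have "R ! x l = R ! 0 + (\<Sum>i<l. d (x i))" for l
    using level[of 0 l] by (simp add: x0 atLeast0LessThan)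
  ultimately show thesis using that x0 range by blast
qed

text \<open>The steps of \<open>D\<close>, read in the order of the walk, form \<open>D'\<close>.
  Its ranks are the levels of the walk measured from the lowest start \<open>R ! 0\<close>, hence
  nonnegative, and sorting by them undoes the walk.\<close>

lemma balanced_preimage:
  assumes len: "length R = m + n" and srt: "sorted R" and bal: "balanced m n \<Sigma> R"
  shows "sorted_wrt (<) R \<and>
    (\<exists>D'\<in>dyck_paths m n. sweep m n D' = D \<and>
      0 # map (\<lambda>r. r - hd R) (tl R) = sort (rank_seq m n D'))"
proof -
  obtain x where x: "x 0 = 0" "bij_betw x {..<m + n} {..<m + n}"
      "inj_on (\<lambda>i. R ! i) {..<m + n}" "\<And>l. x l < m + n"
      "\<And>l. R ! x l = R ! 0 + (\<Sum>i<l. d (x i))"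
    using balanced_walk[OF bal] by blast
  have "distinct R" using x(3) len by (auto simp: distinct_conv_nth inj_on_def)
  then have strict: "sorted_wrt (<) R" using srt by (simp add: strict_sorted_iff)
  define D' where "D' = map (\<lambda>l. D ! x l) [0..<m + n]"
  \<comment> \<open>Reordering along \<open>x\<close> preserves the multiset of the steps and that
    of the steps paired with their ranks.\<close>
  have mset_x: "image_mset x (mset [0..<m + n]) = mset [0..<m + n]"
    using x(2) by (simp add: bij_betw_def image_mset_mset_set atLeast0LessThan)
  have D_eq: "D = map (\<lambda>i. D ! i) [0..<m + n]" using map_nth[of D] length_D by simp
  have "mset D' = image_mset (\<lambda>i. D ! i) (image_mset x (mset [0..<m + n]))"
    by (simp add: D'_def comp_def multiset.map_comp)
  also have "\<dots> = mset D" unfolding mset_x by (subst (2) D_eq) simp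
  finally have "count_list D' a = count_list D a" for a
    by (metis count_mset)
  \<comment> \<open>The case \<open>l = m + n\<close> is the end point of \<open>D'\<close>, which
    the Dyck condition tests too; the walk continues past its first \<open>m + n\<close>
    arrows.\<close>
  moreover have sum_D': "(\<Sum>i<l. displacement m n (letter_of (D' ! i))) = R ! x l - R ! 0"
    if "l \<le> m + n" for l
    using that x(4) by (simp add: D'_def nth_word x(5))
  moreover have "R ! 0 \<le> R ! x l" for l using srt len x(4) by (simp add: sorted_nth_mono)
  ultimately have dyck': "D' \<in> dyck_paths m n"
    using dyck m_pos by (simp add: dyck_paths_iff) (simp add: D'_def)
  have rank: "rank_seq m n D' = map (\<lambda>l. R ! x l - R ! 0) [0..<m + n]"
    using sum_D' by (intro nth_equalityI)
      (auto simp: rank_seq_def length_ranks_from ranks_from_nth D'_def)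
  have R_eq: "R = map (\<lambda>i. R ! i) [0..<m + n]" using map_nth[of R] len by simp
  \<comment> \<open>The expected result of the sorting: the pairs of rank and step in the order of
    the diagram.\<close>
  let ?P = "map (\<lambda>i. (R ! i - R ! 0, D ! i)) [0..<m + n]"
  have zip: "zip (rank_seq m n D') D' = map (\<lambda>l. (R ! x l - R ! 0, D ! x l)) [0..<m + n]"
    unfolding rank by (simp add: D'_def zip_map_map) (simp add: zip_same_conv_map)
  have "mset (zip (rank_seq m n D') D') =
      image_mset (\<lambda>i. (R ! i - R ! 0, D ! i)) (image_mset x (mset [0..<m + n]))"
    by (simp add: zip comp_def multiset.map_comp)
  also have "\<dots> = mset ?P" unfolding mset_x by simp
  finally have mset_zip: "mset (zip (rank_seq m n D') D') = mset ?P" .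
  have fst_P: "map fst ?P = map (\<lambda>r. r - R ! 0) R"
    by (subst (4) R_eq) (simp add: comp_def)
  have sorted_P: "sorted (map fst ?P)"
    unfolding fst_P using srt by (simp add: sorted_wrt_map)
  \<comment> \<open>Distinct levels give distinct keys, so the multiset of pairs determines the
    sorted list.\<close>
  have "inj_on fst (set ?P)" by (auto intro!: inj_onI dest: inj_onD[OF x(3)])
  then have "inj_on fst (set (zip (rank_seq m n D') D'))" using mset_zip by (metis set_mset_mset)
  then have "sort_key fst (zip (rank_seq m n D') D') = ?P"
    using mset_zip sorted_P by (intro sort_key_inj_key_eq)
  then have "sweep m n D' = map snd ?P" by (simp only: sweep_def)
  also have "\<dots> = D" by (subst (2) D_eq) (simp add: comp_def)
  finally have sweep: "sweep m n D' = D" .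
  have "mset (map fst (zip (rank_seq m n D') D')) = mset (map fst ?P)"
    using mset_zip by (metis mset_map)
  moreover have "map fst (zip (rank_seq m n D') D') = rank_seq m n D'"
    by (simp add: rank_seq_def length_ranks_from)
  ultimately have "sort (rank_seq m n D') = map fst ?P"
    using sorted_P by (metis properties_for_sort)
  also have "\<dots> = 0 # map (\<lambda>r. r - hd R) (tl R)"
    unfolding fst_P using len m_pos by (cases R) auto
  finally show ?thesis using strict dyck' sweep by metis
qed

end

theorem theorem2:
  fixes m n :: nat and D :: "step list" and \<Sigma> :: "letter list" and R0 :: "int list"
  assumes "0 < m" and "0 < n" and "coprime m n"
    and "D \<in> dyck_paths m n" and "\<Sigma> = sw_word D"
    and "length R0 = m + n" and "sorted R0" and "\<forall>r\<in>set R0. 0 \<le> r"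
  shows "\<exists>R. weak_find_rank m n \<Sigma> R0 R \<and> length R = m + n \<and> balanced m n \<Sigma> R \<and>
           sorted_wrt (<) R \<and>
           (\<exists>D'\<in>dyck_paths m n. sweep m n D' = D \<and>
              0 # map (\<lambda>r. r - hd R) (tl R) = sort (rank_seq m n D'))"
proof -
  interpret dyck_word m n D \<Sigma> using assms(1-5) by unfold_locales
  obtain R where R: "weak_find_rank m n \<Sigma> R0 R" using terminates[OF assms(6,7)] by blast
  then have "length R = m + n" "sorted R" "wfr_halted m n \<Sigma> R"
    using rtranclp_step_invariants[of m n \<Sigma> R0 R] assms(6,7) by (auto simp: weak_find_rank_def)
  moreover from this have "balanced m n \<Sigma> R" by (intro halted_balanced)
  ultimately show ?thesis using R balanced_preimage by blast
qed

end
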